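(* Let $d,n\ge 1$ be integers and let $\delta > 0$. Suppose there are $n$ points $x_1, \dots, x_n \in \mathbb{R}P^d$ such that every point $y \in \mathbb{R}P^d$ is at distance strictly less than $\delta$ from at least one of the points $x_j$. Then there is a continuous odd map $S^d_{\pi-2\delta} \to S^{n-1}$.
   Context: $S^d\subset\mathbb{R}^{d+1}$ is the unit sphere with the geodesic (angular) metric $d(x,y)=\arccos\langle x,y\rangle$ and the antipodal involution $x\mapsto -x$. $\mathbb{R}P^d=S^d/(x\sim -x)$ carries the quotient metric: the distance between two points is the angle in $[0,\pi/2]$ between the corresponding lines. For a metric space $X$ and a real number $r$, the (Vietoris--Rips) metric thickening $X_r$ is the set of probability measures $\mu=\sum_i\lambda_i x_i$ on $X$ (finite convex combinations of Dirac measures) whose support is finite and has diameter at most $r$, equipped with the $1$-Wasserstein metric; it is empty if $r<0$. The involution on $S^d$ induces the involution $\sum_i\lambda_i x_i\mapsto\sum_i\lambda_i(-x_i)$ on $S^d_r$. A map between spaces with involutions is odd if it commutes with the involutions. *)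

theory Defs
  imports "HOL-Probability.Probability"
begin

section \<open>The 1-Wasserstein distance\<close>

definition couplings :: "'a pmf \<Rightarrow> 'a pmf \<Rightarrow> ('a \<times> 'a) pmf set" where
  "couplings \<mu> \<nu> = {\<pi>. map_pmf fst \<pi> = \<mu> \<and> map_pmf snd \<pi> = \<nu>}"

definition wasserstein :: "('a \<Rightarrow> 'a \<Rightarrow> real) \<Rightarrow> 'a pmf \<Rightarrow> 'a pmf \<Rightarrow> real" where
  "wasserstein d \<mu> \<nu> =
     (INF \<pi>\<in>couplings \<mu> \<nu>. measure_pmf.expectation \<pi> (\<lambda>(x, y). d x y))"

section \<open>Vietoris--Rips metric thickenings\<close>

text \<open>A finite convex combination of Dirac measures is a \<open>pmf\<close> with finite support.
  For negative \<open>r\<close> the set below is empty, see \<open>vr_thickening_empty\<close>.\<close>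

definition vr_thickening :: "'a set \<Rightarrow> ('a \<Rightarrow> 'a \<Rightarrow> real) \<Rightarrow> real \<Rightarrow> 'a pmf set" where
  "vr_thickening X d r =
     {\<mu>. finite (set_pmf \<mu>) \<and> set_pmf \<mu> \<subseteq> X \<and> (\<forall>x\<in>set_pmf \<mu>. \<forall>y\<in>set_pmf \<mu>. d x y \<le> r)}"

definition vr_topology :: "'a set \<Rightarrow> ('a \<Rightarrow> 'a \<Rightarrow> real) \<Rightarrow> real \<Rightarrow> 'a pmf topology" where
  "vr_topology X d r = Metric_space.mtopology (vr_thickening X d r) (wasserstein d)"

section \<open>The sphere and the projective space\<close>

text \<open>The locale \<open>Metric_space\<close> asks for a distance that is nonnegative on the whole type, hence
  the value 0 off the sphere.\<close>

definition geo_dist :: "'a::euclidean_space \<Rightarrow> 'a \<Rightarrow> real" where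
  "geo_dist x y = (if x \<in> sphere 0 1 \<and> y \<in> sphere 0 1 then arccos (x \<bullet> y) else 0)"

definition antipodal_rel :: "('a::euclidean_space \<times> 'a) set" where
  "antipodal_rel = {(x, y). x \<in> sphere 0 1 \<and> y \<in> sphere 0 1 \<and> (y = x \<or> y = - x)}"

definition proj_space :: "'a::euclidean_space set set" where
  "proj_space = sphere 0 1 // antipodal_rel"

text \<open>The involution is an isometry, so the quotient metric is the minimal distance between
  representatives; \<open>proj_dist_classes\<close> identifies it as the angle between two lines.\<close>

definition proj_dist :: "'a::euclidean_space set \<Rightarrow> 'a set \<Rightarrow> real" where
  "proj_dist P Q = (INF (x, y)\<in>P \<times> Q. geo_dist x y)"

definition antipode :: "'a::euclidean_space pmf \<Rightarrow> 'a pmf" where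
  "antipode \<mu> = map_pmf uminus \<mu>"

section \<open>Basic facts\<close>

lemma equiv_antipodal_rel: "equiv (sphere 0 1) antipodal_rel"
  by (auto simp: equiv_def refl_on_def sym_def trans_def antipodal_rel_def)

lemma antipodal_class:
  "x \<in> sphere 0 1 \<Longrightarrow> antipodal_rel `` {x} = {x, - x}"
  by (auto simp: antipodal_rel_def)

lemma inner_sphere_bounds:
  fixes x y :: "'a::euclidean_space"
  assumes "x \<in> sphere 0 1" "y \<in> sphere 0 1"
  shows "- 1 \<le> x \<bullet> y" "x \<bullet> y \<le> 1" "\<bar>x \<bullet> y\<bar> \<le> 1"
  using Cauchy_Schwarz_ineq2[of x y] assms by auto

lemma proj_dist_classes:
  fixes x y :: "'a::euclidean_space"
  assumes "x \<in> sphere 0 1" "y \<in> sphere 0 1"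
  shows "proj_dist (antipodal_rel `` {x}) (antipodal_rel `` {y}) = arccos \<bar>x \<bullet> y\<bar>"
proof -
  have b: "- 1 \<le> x \<bullet> y" "x \<bullet> y \<le> 1" using inner_sphere_bounds[OF assms] by auto
  have "proj_dist (antipodal_rel `` {x}) (antipodal_rel `` {y})
      = Inf {arccos (x \<bullet> y), arccos (- (x \<bullet> y))}"
    using assms unfolding antipodal_class[OF assms(1)] antipodal_class[OF assms(2)] proj_dist_def
    by (intro arg_cong[where f = Inf]) (auto simp: geo_dist_def image_iff)
  also have "\<dots> = min (arccos (x \<bullet> y)) (arccos (- (x \<bullet> y)))"
    by (simp add: cInf_eq_Min)
  also have "\<dots> = arccos \<bar>x \<bullet> y\<bar>"
    using b by (auto simp: min_def abs_if arccos_le_mono)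
  finally show ?thesis .
qed

lemma geo_dist_triangle:
  fixes x y z :: "'a::euclidean_space"
  assumes "x \<in> sphere 0 1" "y \<in> sphere 0 1" "z \<in> sphere 0 1"
  shows "geo_dist x z \<le> geo_dist x y + geo_dist y z"
proof -
  define p q where "p = x \<bullet> y" and "q = y \<bullet> z"
  have n: "x \<bullet> x = 1" "y \<bullet> y = 1" "z \<bullet> z = 1"
    using assms by (auto simp: dot_square_norm)
  have bp: "\<bar>p\<bar> \<le> 1" and bq: "\<bar>q\<bar> \<le> 1" and bx: "\<bar>x \<bullet> z\<bar> \<le> 1"
    using inner_sphere_bounds assms p_def q_def by blast+
  define u v where "u = x - p *\<^sub>R y" and "v = z - q *\<^sub>R y"
  have "u \<bullet> u = 1 - p\<^sup>2" "v \<bullet> v = 1 - q\<^sup>2" and uv: "u \<bullet> v = x \<bullet> z - p * q"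
    using n unfolding u_def v_def
    by (auto simp: inner_diff_left inner_diff_right p_def q_def inner_commute power2_eq_square)
  then have nu: "norm u = sqrt (1 - p\<^sup>2)" and nv: "norm v = sqrt (1 - q\<^sup>2)"
    by (auto simp: norm_eq_sqrt_inner)
  have "- (u \<bullet> v) \<le> norm u * norm v"
    using Cauchy_Schwarz_ineq2[of u v] by linarith
  then have "p * q - sqrt (1 - p\<^sup>2) * sqrt (1 - q\<^sup>2) \<le> x \<bullet> z"
    using uv nu nv by simp
  then have c: "cos (arccos p + arccos q) \<le> x \<bullet> z"
    using bp bq by (simp add: cos_add cos_arccos_abs sin_arccos_abs)
  have "arccos (x \<bullet> z) \<le> arccos p + arccos q"
  proof (cases "arccos p + arccos q \<le> pi")
    case True
    have "arccos (x \<bullet> z) \<le> arccos (cos (arccos p + arccos q))"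
      using c bx by (intro arccos_le_arccos) auto
    also have "\<dots> = arccos p + arccos q"
      using True bp bq arccos_lbound by (intro arccos_cos) (auto simp: abs_le_iff)
    finally show ?thesis .
  next
    case False
    then show ?thesis using arccos_ubound[of "x \<bullet> z"] bx by (auto simp: abs_le_iff)
  qed
  then show ?thesis using assms by (simp add: geo_dist_def p_def q_def)
qed

lemma Metric_space_geo_dist: "Metric_space (sphere (0::'a::euclidean_space) 1) geo_dist"
proof
  fix x y :: 'a
  show "0 \<le> geo_dist x y"
    using inner_sphere_bounds[of x y] by (auto simp: geo_dist_def intro!: arccos_lbound)
  show "geo_dist x y = geo_dist y x"
    by (simp add: geo_dist_def inner_commute)
  assume xy: "x \<in> sphere 0 1" "y \<in> sphere 0 1"
  have "arccos (x \<bullet> y) = 0 \<longleftrightarrow> x \<bullet> y = 1"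
    using inner_sphere_bounds[OF xy] by (metis arccos_1 cos_arccos cos_zero)
  also have "\<dots> \<longleftrightarrow> x = y"
    using xy norm_cauchy_schwarz_eq[of x y] by (auto simp: dot_square_norm)
  finally show "geo_dist x y = 0 \<longleftrightarrow> x = y"
    using xy by (simp add: geo_dist_def)
qed (rule geo_dist_triangle)

lemma vr_thickening_empty:
  assumes "Metric_space X d" "r < 0"
  shows "vr_thickening X d r = {}"
proof -
  interpret Metric_space X d by fact
  have "\<mu> \<notin> vr_thickening X d r" for \<mu>
  proof
    assume *: "\<mu> \<in> vr_thickening X d r"
    obtain x where "x \<in> set_pmf \<mu>" using set_pmf_not_empty[of \<mu>] by blast
    then have "d x x \<le> r" using * by (simp add: vr_thickening_def)
    then show False using nonneg[of x x] assms(2) by linarith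
  qed
  then show ?thesis by blast
qed

lemma antipode_vr_thickening:
  "\<mu> \<in> vr_thickening (sphere 0 1) geo_dist r \<Longrightarrow>
   antipode \<mu> \<in> vr_thickening (sphere 0 1) geo_dist r"
  by (fastforce simp: vr_thickening_def antipode_def geo_dist_def subset_iff)

lemma pair_pmf_coupling: "pair_pmf \<mu> \<nu> \<in> couplings \<mu> \<nu>"
  by (simp add: couplings_def map_fst_pair_pmf map_snd_pair_pmf)

lemma finite_coupling:
  assumes "\<pi> \<in> couplings \<mu> \<nu>" "finite (set_pmf \<mu>)" "finite (set_pmf \<nu>)"
  shows "finite (set_pmf \<pi>)" and "set_pmf \<pi> \<subseteq> set_pmf \<mu> \<times> set_pmf \<nu>"
proof -
  show *: "set_pmf \<pi> \<subseteq> set_pmf \<mu> \<times> set_pmf \<nu>"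
    using assms(1) unfolding couplings_def by (force simp: image_iff)
  show "finite (set_pmf \<pi>)"
    using assms(2,3) by (intro finite_subset[OF *]) auto
qed

lemma wasserstein_le:
  assumes "\<And>x y. 0 \<le> d x y" "\<pi> \<in> couplings \<mu> \<nu>"
  shows "wasserstein d \<mu> \<nu> \<le> measure_pmf.expectation \<pi> (\<lambda>(x, y). d x y)"
  unfolding wasserstein_def using assms
  by (intro cINF_lower bdd_belowI2[where m = 0]) (auto intro!: integral_nonneg_AE)

lemma wasserstein_ge:
  assumes "\<And>\<pi>. \<pi> \<in> couplings \<mu> \<nu> \<Longrightarrow> c \<le> measure_pmf.expectation \<pi> (\<lambda>(x, y). d x y)"
  shows "c \<le> wasserstein d \<mu> \<nu>"
  unfolding wasserstein_def using assms pair_pmf_coupling by (intro cINF_greatest) auto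

lemma wasserstein_lipschitz:
  fixes g :: "'a \<Rightarrow> real"
  assumes d: "\<And>x y. 0 \<le> d x y"
    and fin: "finite (set_pmf \<mu>)" "finite (set_pmf \<nu>)"
    and L: "0 < L"
    and g: "\<And>x y. x \<in> set_pmf \<mu> \<Longrightarrow> y \<in> set_pmf \<nu> \<Longrightarrow> \<bar>g x - g y\<bar> \<le> L * d x y"
  shows "\<bar>measure_pmf.expectation \<mu> g - measure_pmf.expectation \<nu> g\<bar> \<le> L * wasserstein d \<mu> \<nu>"
proof -
  have "\<bar>measure_pmf.expectation \<mu> g - measure_pmf.expectation \<nu> g\<bar> / L
      \<le> measure_pmf.expectation \<pi> (\<lambda>(x, y). d x y)" if \<pi>: "\<pi> \<in> couplings \<mu> \<nu>" for \<pi>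
  proof -
    have fin\<pi>: "finite (set_pmf \<pi>)" and sub: "set_pmf \<pi> \<subseteq> set_pmf \<mu> \<times> set_pmf \<nu>"
      using finite_coupling[OF \<pi> fin] by auto
    note int = integrable_measure_pmf_finite[OF fin\<pi>]
    have m: "\<mu> = map_pmf fst \<pi>" "\<nu> = map_pmf snd \<pi>" using \<pi> by (auto simp: couplings_def)
    have "measure_pmf.expectation \<mu> g - measure_pmf.expectation \<nu> g
        = measure_pmf.expectation \<pi> (\<lambda>p. g (fst p) - g (snd p))"
      unfolding m by (simp add: Bochner_Integration.integral_diff[OF int int])
    also have "\<bar>\<dots>\<bar> \<le> measure_pmf.expectation \<pi> (\<lambda>p. \<bar>g (fst p) - g (snd p)\<bar>)"
      using integral_norm_bound[of \<pi> "\<lambda>p. g (fst p) - g (snd p)"] by simp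
    also have "\<dots> \<le> measure_pmf.expectation \<pi> (\<lambda>p. L * (case p of (x, y) \<Rightarrow> d x y))"
      using sub by (intro integral_mono_AE int) (auto simp: AE_measure_pmf_iff intro!: g)
    also have "\<dots> = L * measure_pmf.expectation \<pi> (\<lambda>(x, y). d x y)" by simp
    finally show ?thesis using L by (simp add: field_simps)
  qed
  then have "\<bar>measure_pmf.expectation \<mu> g - measure_pmf.expectation \<nu> g\<bar> / L \<le> wasserstein d \<mu> \<nu>"
    by (rule wasserstein_ge)
  then show ?thesis using L by (simp add: field_simps)
qed

lemma wasserstein_nonneg:
  "(\<And>x y. 0 \<le> d x y) \<Longrightarrow> 0 \<le> wasserstein d \<mu> \<nu>"
  by (rule wasserstein_ge) (auto intro!: integral_nonneg_AE)

lemma wasserstein_commute_le: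
  assumes "\<And>x y. 0 \<le> d x y" "\<And>x y. d x y = d y x"
  shows "wasserstein d \<mu> \<nu> \<le> wasserstein d \<nu> \<mu>"
proof (rule wasserstein_ge)
  fix \<pi> assume "\<pi> \<in> couplings \<nu> \<mu>"
  then have "map_pmf prod.swap \<pi> \<in> couplings \<mu> \<nu>"
    by (auto simp: couplings_def map_pmf_comp)
  from wasserstein_le[of d, OF assms(1) this]
  show "wasserstein d \<mu> \<nu> \<le> measure_pmf.expectation \<pi> (\<lambda>(x, y). d x y)"
    using assms(2) by (simp add: case_prod_unfold)
qed

lemma glue_couplings:
  assumes "\<pi> \<in> couplings \<mu> \<nu>" "\<rho> \<in> couplings \<nu> \<sigma>"
  obtains \<tau> where "map_pmf (\<lambda>(x, y, z). (x, y)) \<tau> = \<pi>" "map_pmf (\<lambda>(x, y, z). (y, z)) \<tau> = \<rho>"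
proof -
  define K where "K y = cond_pmf \<rho> {p. fst p = y}" for y
  have \<nu>: "\<nu> = map_pmf fst \<rho>" "\<nu> = map_pmf snd \<pi>" using assms by (auto simp: couplings_def)
  have ne: "set_pmf \<rho> \<inter> {p. fst p = y} \<noteq> {}" if "y \<in> set_pmf \<nu>" for y
    using that unfolding \<nu>(1) by auto
  have \<rho>: "bind_pmf \<nu> K = \<rho>"
    unfolding K_def
  proof (rule bind_cond_pmf_cancel)
    fix y p assume "y \<in> set_pmf \<nu>" "p \<in> set_pmf \<rho>" "fst p = y"
    then have "{x. fst p = x} = {y}" by auto
    then show "measure \<rho> {p. fst p = y} = measure \<nu> {x. fst p = x}"
      unfolding \<nu>(1) by (simp add: map_pmf_rep_eq measure_distr vimage_def)
  qed (use ne \<nu> in auto)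
  have fstK: "fst q = y" if "y \<in> set_pmf \<nu>" "q \<in> set_pmf (K y)" for y q
    using that(2) set_cond_pmf[OF ne[OF that(1)]] by (auto simp: K_def)
  have s: "snd p \<in> set_pmf \<nu>" if "p \<in> set_pmf \<pi>" for p using that \<nu>(2) by simp
  define \<tau> where "\<tau> = bind_pmf \<pi> (\<lambda>p. map_pmf (\<lambda>q. (fst p, snd p, snd q)) (K (snd p)))"
  have "map_pmf (\<lambda>(x, y, z). (x, y)) \<tau> = \<pi>"
    by (simp add: \<tau>_def map_bind_pmf map_pmf_comp bind_return_pmf' map_pmf_const)
  moreover have "map_pmf (\<lambda>(x, y, z). (y, z)) \<tau> = bind_pmf \<pi> (\<lambda>p. K (snd p))"
    unfolding \<tau>_def map_bind_pmf
    by (intro bind_pmf_cong refl)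
       (auto simp: map_pmf_comp dest!: s fstK intro!: map_pmf_idI)
  moreover have "bind_pmf \<pi> (\<lambda>p. K (snd p)) = \<rho>"
    using \<rho> unfolding \<nu>(2) by (simp add: bind_map_pmf)
  ultimately show ?thesis using that by simp
qed

lemma wasserstein_triangle:
  assumes "Metric_space X d"
    and fin: "finite (set_pmf \<mu>)" "finite (set_pmf \<nu>)" "finite (set_pmf \<sigma>)"
    and X: "set_pmf \<mu> \<subseteq> X" "set_pmf \<nu> \<subseteq> X" "set_pmf \<sigma> \<subseteq> X"
  shows "wasserstein d \<mu> \<sigma> \<le> wasserstein d \<mu> \<nu> + wasserstein d \<nu> \<sigma>"
proof -
  interpret Metric_space X d by fact
  let ?E = "\<lambda>\<pi>. measure_pmf.expectation \<pi> (\<lambda>(x, y). d x y)"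
  have main: "wasserstein d \<mu> \<sigma> \<le> ?E \<pi> + ?E \<rho>"
    if \<pi>: "\<pi> \<in> couplings \<mu> \<nu>" and \<rho>: "\<rho> \<in> couplings \<nu> \<sigma>" for \<pi> \<rho>
  proof -
    obtain \<tau> where \<tau>: "\<pi> = map_pmf (\<lambda>(x, y, z). (x, y)) \<tau>" "\<rho> = map_pmf (\<lambda>(x, y, z). (y, z)) \<tau>"
      using glue_couplings[OF \<pi> \<rho>] by metis
    have m: "\<mu> = map_pmf fst \<tau>" "\<nu> = map_pmf (\<lambda>t. fst (snd t)) \<tau>" "\<sigma> = map_pmf (\<lambda>t. snd (snd t)) \<tau>"
      using \<pi> \<rho> unfolding \<tau> couplings_def by (auto simp: map_pmf_comp case_prod_unfold)
    have sub: "set_pmf \<tau> \<subseteq> set_pmf \<mu> \<times> set_pmf \<nu> \<times> set_pmf \<sigma>"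
      unfolding m by (force simp: image_iff)
    then have "finite (set_pmf \<tau>)" by (rule finite_subset) (use fin in auto)
    note int = integrable_measure_pmf_finite[OF this]
    have "map_pmf (\<lambda>(x, y, z). (x, z)) \<tau> \<in> couplings \<mu> \<sigma>"
      unfolding couplings_def m by (auto simp: map_pmf_comp case_prod_unfold)
    then have "wasserstein d \<mu> \<sigma> \<le> ?E (map_pmf (\<lambda>(x, y, z). (x, z)) \<tau>)"
      by (intro wasserstein_le) auto
    also have "\<dots> = measure_pmf.expectation \<tau> (\<lambda>(x, y, z). d x z)"
      by (simp add: case_prod_unfold)
    also have "\<dots> \<le> measure_pmf.expectation \<tau> (\<lambda>t. (case t of (x, y, z) \<Rightarrow> d x y) + (case t of (x, y, z) \<Rightarrow> d y z))"
      using sub X by (intro integral_mono_AE int) (auto simp: AE_measure_pmf_iff intro!: triangle)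
    also have "\<dots> = measure_pmf.expectation \<tau> (\<lambda>(x, y, z). d x y) + measure_pmf.expectation \<tau> (\<lambda>(x, y, z). d y z)"
      by (rule Bochner_Integration.integral_add[OF int int])
    also have "\<dots> = ?E \<pi> + ?E \<rho>"
      unfolding \<tau> by (simp add: case_prod_unfold)
    finally show ?thesis .
  qed
  have "wasserstein d \<mu> \<sigma> - ?E \<rho> \<le> wasserstein d \<mu> \<nu>" if "\<rho> \<in> couplings \<nu> \<sigma>" for \<rho>
    using main[OF _ that] by (intro wasserstein_ge) (simp add: algebra_simps)
  then have "wasserstein d \<mu> \<sigma> - wasserstein d \<mu> \<nu> \<le> wasserstein d \<nu> \<sigma>"
    by (intro wasserstein_ge) (simp add: algebra_simps)
  then show ?thesis by simp
qed

lemma wasserstein_eq_0D: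
  assumes "Metric_space X d"
    and fin: "finite (set_pmf \<mu>)" "finite (set_pmf \<nu>)"
    and X: "set_pmf \<mu> \<subseteq> X" "set_pmf \<nu> \<subseteq> X"
    and 0: "wasserstein d \<mu> \<nu> = 0"
  shows "\<mu> = \<nu>"
proof (rule pmf_eqI)
  fix a
  interpret Metric_space X d by fact
  define D where "D = insert 1 ((\<lambda>(x, y). d x y) ` {p \<in> set_pmf \<mu> \<times> set_pmf \<nu>. fst p \<noteq> snd p})"
  have finD: "finite D" using fin by (auto simp: D_def)
  have "0 < t" if "t \<in> D" for t
    using that X zero nonneg unfolding D_def by (force simp: less_le)
  then have pos: "0 < Min D" using finD by (auto simp: D_def)
  have "\<bar>measure_pmf.expectation \<mu> (indicator {a}) - measure_pmf.expectation \<nu> (indicator {a} :: _ \<Rightarrow> real)\<bar>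
      \<le> (1 / Min D) * wasserstein d \<mu> \<nu>"
  proof (rule wasserstein_lipschitz)
    fix x y assume xy: "x \<in> set_pmf \<mu>" "y \<in> set_pmf \<nu>"
    show "\<bar>indicator {a} x - indicator {a} y\<bar> \<le> (1 / Min D) * d x y"
    proof (cases "x = y")
      case False
      then have "d x y \<in> D" using xy by (force simp: D_def)
      then have "Min D \<le> d x y" using finD by simp
      then have "1 \<le> (1 / Min D) * d x y" using pos by (simp add: field_simps)
      then show ?thesis by (auto simp: indicator_def)
    qed (use pos in simp)
  qed (use fin pos in auto)
  then show "pmf \<mu> a = pmf \<nu> a" using 0 by (simp add: measure_pmf_single)
qed

lemma Metric_space_vr_thickening:
  assumes "Metric_space X d"
  shows "Metric_space (vr_thickening X d r) (wasserstein d)"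
proof -
  interpret Metric_space X d by fact
  show ?thesis
  proof
    fix \<mu> \<nu> :: "'a pmf"
    show "0 \<le> wasserstein d \<mu> \<nu>" by (simp add: wasserstein_nonneg)
    show "wasserstein d \<mu> \<nu> = wasserstein d \<nu> \<mu>"
      using wasserstein_commute_le[of d] commute by (intro antisym) auto
    assume \<mu>\<nu>: "\<mu> \<in> vr_thickening X d r" "\<nu> \<in> vr_thickening X d r"
    have "wasserstein d \<mu> \<mu> = 0"
    proof (rule antisym)
      have "map_pmf (\<lambda>x. (x, x)) \<mu> \<in> couplings \<mu> \<mu>"
        by (simp add: couplings_def map_pmf_comp)
      from wasserstein_le[of d, OF _ this]
      have "wasserstein d \<mu> \<mu> \<le> measure_pmf.expectation \<mu> (\<lambda>x. d x x)" by simp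
      also have "\<dots> = measure_pmf.expectation \<mu> (\<lambda>x. 0)"
        using \<mu>\<nu>(1) by (intro integral_cong_AE) (auto simp: AE_measure_pmf_iff vr_thickening_def subset_iff)
      finally show "wasserstein d \<mu> \<mu> \<le> 0" by simp
    qed (simp add: wasserstein_nonneg)
    then show "wasserstein d \<mu> \<nu> = 0 \<longleftrightarrow> \<mu> = \<nu>"
      using wasserstein_eq_0D[OF assms] \<mu>\<nu> by (auto simp: vr_thickening_def)
  next
    fix \<mu> \<nu> \<sigma>
    assume "\<mu> \<in> vr_thickening X d r" "\<nu> \<in> vr_thickening X d r" "\<sigma> \<in> vr_thickening X d r"
    then show "wasserstein d \<mu> \<sigma> \<le> wasserstein d \<mu> \<nu> + wasserstein d \<nu> \<sigma>"
      by (intro wasserstein_triangle[OF assms]) (auto simp: vr_thickening_def)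
  qed
qed

end

theory Submission
  imports Defs
begin

text \<open>
  Lift the points to unit vectors \<open>v\<^sub>1, \<dots>, v\<^sub>n\<close>. Every point of the sphere then lies in one of the
  open caps of radius \<open>\<delta>\<close> around the \<open>\<plusminus> v\<^sub>j\<close>. Let \<open>h\<^sub>j\<close> be a bump on the cap around \<open>v\<^sub>j\<close> minus the
  same bump on the cap around \<open>- v\<^sub>j\<close>, and send a measure \<open>\<mu>\<close> to the vector \<open>F \<mu>\<close> of the integrals
  \<open>\<integral> h\<^sub>j d\<mu>\<close>. Each \<open>h\<^sub>j\<close> is odd, hence so is \<open>F\<close>; each \<open>h\<^sub>j\<close> is Lipschitz, hence \<open>F\<close> is
  Lipschitz in each coordinate for the 1-Wasserstein distance
  (\<open>continuous_map_expectation\<close>).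

  The bound on the diameter of the support keeps \<open>F\<close> away from 0. The points \<open>v\<^sub>j\<close> and \<open>- v\<^sub>j\<close> are
  at distance \<open>\<pi>\<close>, so a point of the open cap around \<open>v\<^sub>j\<close> and a point of the open cap around
  \<open>- v\<^sub>j\<close> are more than \<open>\<pi> - 2\<delta>\<close> apart (\<open>bump_antipodal_separation\<close>), and the support of
  \<open>\<mu>\<close> cannot meet both. A point of the support lies in the cap around some \<open>\<plusminus> v\<^sub>j\<close>, and for this \<open>j\<close>
  the function \<open>h\<^sub>j\<close> has one sign on the support and is not 0 at that point, so neither is its integral
  (\<open>expectation_odd_bump_pos\<close>). Normalising \<open>F\<close> gives the map to the sphere.
\<close>

definition bump :: "real \<Rightarrow> 'a::euclidean_space \<Rightarrow> 'a \<Rightarrow> real" where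
  "bump \<delta> v y = max 0 (\<delta> - geo_dist v y)"

definition odd_bump :: "real \<Rightarrow> 'a::euclidean_space \<Rightarrow> 'a \<Rightarrow> real" where
  "odd_bump \<delta> v y = bump \<delta> v y - bump \<delta> (- v) y"

text \<open>Moving \<open>y\<close> to \<open>- y\<close> exchanges its distances to \<open>v\<close> and \<open>- v\<close>. Off the sphere both distances
  take the default value 0, so the two bumps cancel there and oddness holds on the whole space.\<close>

lemma odd_bump_uminus: "odd_bump \<delta> v (- y) = - odd_bump \<delta> v y"
  by (simp add: odd_bump_def bump_def geo_dist_def)

lemma odd_bump_uminus_center: "odd_bump \<delta> (- v) y = - odd_bump \<delta> v y"
  by (simp add: odd_bump_def)

lemma bump_lipschitz:
  assumes "v \<in> sphere 0 1" "y \<in> sphere 0 1" "z \<in> sphere 0 1"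
  shows "\<bar>bump \<delta> v y - bump \<delta> v z\<bar> \<le> geo_dist y z"
proof -
  interpret Metric_space "sphere (0::'a) 1" geo_dist by (rule Metric_space_geo_dist)
  show ?thesis
    using triangle[OF assms] triangle[OF assms(1,3,2)] commute[of y z]
    unfolding bump_def by linarith
qed

lemma odd_bump_lipschitz:
  assumes "v \<in> sphere 0 1" "y \<in> sphere 0 1" "z \<in> sphere 0 1"
  shows "\<bar>odd_bump \<delta> v y - odd_bump \<delta> v z\<bar> \<le> 2 * geo_dist y z"
  using bump_lipschitz[OF assms, of \<delta>] bump_lipschitz[of "- v" y z \<delta>] assms
  unfolding odd_bump_def by simp

text \<open>If \<open>z\<close> were within \<open>\<delta>\<close> of \<open>- v\<close>, the path \<open>v, y, z, - v\<close> would be shorter than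
  \<open>\<delta> + (\<pi> - 2\<delta>) + \<delta> = \<pi>\<close>, the distance from \<open>v\<close> to \<open>- v\<close>.\<close>

lemma bump_antipodal_separation:
  assumes "v \<in> sphere 0 1" "y \<in> sphere 0 1" "z \<in> sphere 0 1"
    and "geo_dist y z \<le> pi - 2 * \<delta>" and "geo_dist v y < \<delta>"
  shows "bump \<delta> (- v) z = 0"
proof -
  interpret Metric_space "sphere (0::'a) 1" geo_dist by (rule Metric_space_geo_dist)
  have v: "- v \<in> sphere 0 1" using assms(1) by simp
  have "geo_dist v (- v) = pi"
    using assms(1) by (simp add: geo_dist_def dot_square_norm)
  then have "\<delta> \<le> geo_dist (- v) z"
    using triangle[OF assms(1,2) v] triangle[OF assms(2,3) v] assms(4,5) commute[of z "- v"]
    by linarith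
  then show ?thesis by (simp add: bump_def)
qed

text \<open>The negative part of the odd bump vanishes on the whole support, so the expectation is a sum of
  nonnegative terms, and the term of \<open>y\<close> is positive.\<close>

lemma expectation_odd_bump_pos:
  assumes \<mu>: "\<mu> \<in> vr_thickening (sphere 0 1) geo_dist (pi - 2 * \<delta>)"
    and v: "v \<in> sphere 0 1" and y: "y \<in> set_pmf \<mu>" "geo_dist v y < \<delta>"
  shows "measure_pmf.expectation \<mu> (odd_bump \<delta> v) > 0"
proof -
  have diam: "geo_dist y z \<le> pi - 2 * \<delta>" if "z \<in> set_pmf \<mu>" for z
    using \<mu> y that by (auto simp: vr_thickening_def)
  have fin: "finite (set_pmf \<mu>)" and sub: "set_pmf \<mu> \<subseteq> sphere 0 1"
    using \<mu> by (auto simp: vr_thickening_def)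
  have eq: "odd_bump \<delta> v z = bump \<delta> v z" if "z \<in> set_pmf \<mu>" for z
    using bump_antipodal_separation[OF v _ _ diam[OF that] y(2)] subsetD[OF sub y(1)] subsetD[OF sub that]
    by (simp add: odd_bump_def)
  have "0 < pmf \<mu> y * odd_bump \<delta> v y"
    using y eq[OF y(1)] by (simp add: bump_def pmf_positive)
  also have "\<dots> \<le> (\<Sum>z\<in>set_pmf \<mu>. pmf \<mu> z * odd_bump \<delta> v z)"
    by (rule member_le_sum) (use fin y eq in \<open>auto simp: bump_def\<close>)
  also have "\<dots> = measure_pmf.expectation \<mu> (odd_bump \<delta> v)"
    using fin by (subst integral_measure_pmf_real[of "set_pmf \<mu>"])  (auto simp: mult.commute)
  finally show ?thesis .
qed

text \<open>This is the easy half of Kantorovich duality: integrating a Lipschitz function against both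
  marginals of a coupling changes the result by at most the Lipschitz constant times the cost.\<close>

lemma continuous_map_expectation:
  fixes g :: "'a \<Rightarrow> real"
  assumes X: "Metric_space X d" and L: "0 < L"
    and g: "\<And>x y. x \<in> X \<Longrightarrow> y \<in> X \<Longrightarrow> \<bar>g x - g y\<bar> \<le> L * d x y"
  shows "continuous_map (vr_topology X d r) euclidean (\<lambda>\<mu>. measure_pmf.expectation \<mu> g)"
proof -
  interpret Metric_space X d by fact
  interpret W: Metric_space "vr_thickening X d r" "wasserstein d"
    by (rule Metric_space_vr_thickening[OF X])
  have lip: "\<bar>measure_pmf.expectation \<mu> g - measure_pmf.expectation \<nu> g\<bar> \<le> L * wasserstein d \<mu> \<nu>"
    if "\<mu> \<in> vr_thickening X d r" "\<nu> \<in> vr_thickening X d r" for \<mu> \<nu>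
    using that L by (intro wasserstein_lipschitz) (auto simp: vr_thickening_def intro!: g)
  have "continuous_map W.mtopology Met_TC.mtopology (\<lambda>\<mu>. measure_pmf.expectation \<mu> g)"
    unfolding W.metric_continuous_map[OF Met_TC.Metric_space_axioms]
  proof (intro conjI ballI allI impI)
    fix \<mu> \<epsilon> assume \<mu>: "\<mu> \<in> vr_thickening X d r" and "\<epsilon> > (0::real)"
    have "dist (measure_pmf.expectation \<mu> g) (measure_pmf.expectation \<nu> g) < \<epsilon>"
      if "\<nu> \<in> vr_thickening X d r" "wasserstein d \<mu> \<nu> < \<epsilon> / L" for \<nu>
      using lip[OF \<mu> that(1)] that(2) L by (simp add: dist_real_def field_simps)
    then show "\<exists>\<eta>>0. \<forall>\<nu>. \<nu> \<in> vr_thickening X d r \<and> wasserstein d \<mu> \<nu> < \<eta> \<longrightarrow>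
        dist (measure_pmf.expectation \<mu> g) (measure_pmf.expectation \<nu> g) < \<epsilon>"
      using \<open>\<epsilon> > 0\<close> L by (intro exI[of _ "\<epsilon> / L"]) auto
  qed simp
  then show ?thesis by (simp add: vr_topology_def)
qed

lemma continuous_map_vec_lambda:
  fixes F :: "'k::finite \<Rightarrow> 'b \<Rightarrow> real"
  assumes "\<And>j. continuous_map T euclidean (F j)"
  shows "continuous_map T euclidean (\<lambda>\<mu>. \<chi> j. F j \<mu>)"
  using assms unfolding continuous_map_atin limitin_canonical_iff
  by (auto intro!: tendsto_vec_lambda)

text \<open>The covering is stated on the sphere, with the centres indexed by the coordinates of the
  target, because the construction takes place there: the \<open>j\<close>-th coordinate of the map is the
  normalised integral of the odd bump at \<open>v j\<close>.\<close>

lemma odd_map_to_sphere_of_cover: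
  fixes v :: "'k::finite \<Rightarrow> 'a::euclidean_space"
  assumes v: "\<And>j. v j \<in> sphere 0 1"
    and cover: "\<And>y. y \<in> sphere 0 1 \<Longrightarrow> \<exists>j. geo_dist (v j) y < \<delta> \<or> geo_dist (- v j) y < \<delta>"
  shows "\<exists>f :: 'a pmf \<Rightarrow> real ^ 'k.
           continuous_map (vr_topology (sphere 0 1) geo_dist (pi - 2 * \<delta>))
             (top_of_set (sphere 0 1)) f \<and>
           (\<forall>\<mu>\<in>vr_thickening (sphere 0 1) geo_dist (pi - 2 * \<delta>). f (antipode \<mu>) = - f \<mu>)"
proof -
  let ?V = "vr_thickening (sphere (0::'a) 1) geo_dist (pi - 2 * \<delta>)"
  let ?T = "vr_topology (sphere (0::'a) 1) geo_dist (pi - 2 * \<delta>)"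
  define F :: "'a pmf \<Rightarrow> real ^ 'k"
    where "F \<mu> = (\<chi> j. measure_pmf.expectation \<mu> (odd_bump \<delta> (v j)))" for \<mu>
  have T: "topspace ?T = ?V"
    unfolding vr_topology_def
    by (intro Metric_space.topspace_mtopology Metric_space_vr_thickening Metric_space_geo_dist)
  have F: "continuous_map ?T euclidean F"
    unfolding F_def
    by (intro continuous_map_vec_lambda continuous_map_expectation[where L = 2]
          Metric_space_geo_dist odd_bump_lipschitz v) simp
  have nz: "F \<mu> \<noteq> 0" if \<mu>: "\<mu> \<in> ?V" for \<mu>
  proof -
    obtain y where y: "y \<in> set_pmf \<mu>" using set_pmf_not_empty[of \<mu>] by blast
    then have "y \<in> sphere 0 1" using \<mu> by (auto simp: vr_thickening_def)
    then obtain j where "geo_dist (v j) y < \<delta> \<or> geo_dist (- v j) y < \<delta>" using cover by blast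
    then have "F \<mu> $ j \<noteq> 0"
    proof
      assume "geo_dist (v j) y < \<delta>"
      then show ?thesis
        using expectation_odd_bump_pos[OF \<mu> v y, of j] by (simp add: F_def)
    next
      assume "geo_dist (- v j) y < \<delta>"
      then have "0 < measure_pmf.expectation \<mu> (odd_bump \<delta> (- v j))"
        using expectation_odd_bump_pos[OF \<mu> _ y, of "- v j"] v[of j] by simp
      also have "odd_bump \<delta> (- v j) = (\<lambda>z. - odd_bump \<delta> (v j) z)"
        by (simp add: fun_eq_iff odd_bump_uminus_center)
      finally show ?thesis by (simp add: F_def)
    qed
    then show ?thesis by auto
  qed
  have odd: "F (antipode \<mu>) = - F \<mu>" for \<mu>
    by (simp add: F_def antipode_def vec_eq_iff odd_bump_uminus)
  have "continuous_map ?T (top_of_set (- {0})) F"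
    using F nz by (auto simp: continuous_map_in_subtopology T)
  moreover have "continuous_map (top_of_set (- {0 :: real ^ 'k})) (top_of_set (sphere 0 1)) sgn"
    by (auto simp: continuous_map_in_subtopology norm_sgn intro!: continuous_intros)
  ultimately have "continuous_map ?T (top_of_set (sphere 0 1)) (sgn \<circ> F)"
    by (rule continuous_map_compose)
  then show ?thesis
    by (intro exI[of _ "sgn \<circ> F"]) (simp add: odd sgn_minus)
qed

theorem theorem3:
  fixes d n :: nat and \<delta> :: real and x :: "nat \<Rightarrow> (real ^ 'm::finite) set"
  assumes "d \<ge> 1" and "n \<ge> 1"
    and "CARD('m) = d + 1" and "CARD('k::finite) = n"
    and "\<delta> > 0"
    and "\<forall>j\<in>{1..n}. x j \<in> proj_space"
    and "\<forall>y\<in>proj_space. \<exists>j\<in>{1..n}. proj_dist y (x j) < \<delta>"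
  shows "\<exists>f :: (real ^ 'm) pmf \<Rightarrow> real ^ 'k.
           continuous_map (vr_topology (sphere 0 1) geo_dist (pi - 2 * \<delta>))
             (top_of_set (sphere 0 1)) f \<and>
           (\<forall>\<mu>\<in>vr_thickening (sphere 0 1) geo_dist (pi - 2 * \<delta>). f (antipode \<mu>) = - f \<mu>)"
proof -
  have "\<forall>j\<in>{1..n}. \<exists>w\<in>sphere 0 1. x j = antipodal_rel `` {w}"
    using assms(6) by (auto simp: proj_space_def quotient_def)
  \<comment> \<open>Either of the two representatives of a projective point will do: the covering by caps is
    symmetric under changing the sign of a centre.\<close>
  then obtain w where w: "\<And>j. j \<in> {1..n} \<Longrightarrow> w j \<in> sphere 0 1 \<and> x j = antipodal_rel `` {w j}"
    by metis
  obtain e :: "'k \<Rightarrow> nat" where e: "bij_betw e UNIV {1..n}"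
    using finite_same_card_bij[of "UNIV :: 'k set" "{1..n}"] assms(4) by auto
  have we: "w (e k) \<in> sphere 0 1" for k
    using w bij_betwE[OF e] by blast
  show ?thesis
  proof (rule odd_map_to_sphere_of_cover[where v = "w \<circ> e"])
    fix y :: "real ^ 'm" assume y: "y \<in> sphere 0 1"
    then have "antipodal_rel `` {y} \<in> proj_space"
      by (simp add: proj_space_def quotientI)
    then obtain j where j: "j \<in> {1..n}" "proj_dist (antipodal_rel `` {y}) (x j) < \<delta>"
      using assms(7) by blast
    then obtain k where k: "j = e k" using bij_betw_imp_surj_on[OF e] by blast
    have "arccos \<bar>y \<bullet> w j\<bar> < \<delta>"
      using j w[OF j(1)] proj_dist_classes[OF y, of "w j"] by simp
    then show "\<exists>k. geo_dist ((w \<circ> e) k) y < \<delta> \<or> geo_dist (- (w \<circ> e) k) y < \<delta>"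
      using y we[of k] unfolding k
      by (intro exI[of _ k]) (auto simp: geo_dist_def inner_commute abs_if split: if_splits)
  qed (use we in simp)
qed

end
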